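(* Let $X\subset\mathbb{C}$ be a continuum. Then the quotient space $X/\!\sim$ is metrizable and is a locally connected continuum, possibly a single point.
   Context: A continuum is a nonempty compact connected metric space (possibly a single point). $X^o$ and $\partial X$ denote the interior and boundary of $X$ in $\mathbb{C}$. A point $x\in\partial X$ is separated from a point $y\in\partial X$ by a subset $C\subset X$ if there is a separation $\partial X\setminus C=A\cup B$, i.e. a decomposition with $\overline{A}\cap B=A\cap\overline{B}=\emptyset$, such that $x\in A$ and $y\in B$. The modified pseudo-fiber $E_x^*$ of $X$ at $x$ is: $E_x^*=\{x\}$ if $x\in X^o$; and, if $x\in\partial X$, $E_x^*$ is the set of points $y\in\partial X$ that cannot be separated from $x$ by any finite set $C\subset\partial X$. The modified fiber $F_x^*$ of $X$ at $x$ is the connected component of $E_x^*$ containing $x$; it is trivial if $F_x^*=\{x\}$. Let $X_0$ be the union of all the nontrivial fibers $F_x^*$, $x\in X$, and let $\overline{X_0}$ be its closure. The equivalence relation $\sim$ on $X$ is defined by: $x\sim y$ if $x=y$, or if $x\neq y$ belong to the same connected component of $\overline{X_0}$. $X/\!\sim$ carries the quotient topology. A space is locally connected if at each of its points every neighborhood contains a connected neighborhood of that point. *)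

theory Defs
  imports "HOL-Analysis.Analysis"
begin

text \<open>In \<open>separated_by\<close> the closures are taken in the plane; since \<open>A\<close> and \<open>B\<close> lie in
  \<open>frontier X - C\<close>, this agrees with closures relative to that subspace.\<close>

definition separated_by :: "complex set \<Rightarrow> complex set \<Rightarrow> complex \<Rightarrow> complex \<Rightarrow> bool" where
  "separated_by X C x y \<longleftrightarrow>
     (\<exists>A B. frontier X - C = A \<union> B \<and> closure A \<inter> B = {} \<and> A \<inter> closure B = {} \<and> x \<in> A \<and> y \<in> B)"

text \<open>Only points \<open>x\<close> of the closed set \<open>X\<close> matter below, so the second branch is the case
  \<open>x \<in> frontier X\<close>.\<close>

definition mod_pseudo_fiber :: "complex set \<Rightarrow> complex \<Rightarrow> complex set" where
  "mod_pseudo_fiber X x =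
     (if x \<in> interior X then {x}
      else {y \<in> frontier X. \<not> (\<exists>C. finite C \<and> C \<subseteq> frontier X \<and> separated_by X C x y)})"

definition mod_fiber :: "complex set \<Rightarrow> complex \<Rightarrow> complex set" where
  "mod_fiber X x = connected_component_set (mod_pseudo_fiber X x) x"

definition nontrivial_fibers_union :: "complex set \<Rightarrow> complex set" where
  "nontrivial_fibers_union X = \<Union>{mod_fiber X x | x. x \<in> X \<and> mod_fiber X x \<noteq> {x}}"

definition fiber_rel :: "complex set \<Rightarrow> (complex \<times> complex) set" where
  "fiber_rel X = {(x, y). x \<in> X \<and> y \<in> X \<and>
     (x = y \<or> x \<noteq> y \<and> connected_component (closure (nontrivial_fibers_union X)) x y)}"

definition quotient_topology :: "'a topology \<Rightarrow> ('a \<times> 'a) set \<Rightarrow> 'a set topology" where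
  "quotient_topology T R = topology (\<lambda>\<U>. \<U> \<subseteq> topspace T // R \<and> openin T (\<Union>\<U>))"

lemma equiv_fiber_rel: "equiv X (fiber_rel X)"
proof (rule equivI)
  show "fiber_rel X \<subseteq> X \<times> X" "refl_on X (fiber_rel X)"
    by (auto simp: fiber_rel_def refl_on_def)
  show "sym (fiber_rel X)"
    by (auto simp: fiber_rel_def sym_def connected_component_sym)
  show "trans (fiber_rel X)"
    unfolding trans_def fiber_rel_def
    by (auto intro: connected_component_trans)
qed

lemma openin_quotient_topology:
  assumes R: "equiv (topspace T) R"
  shows "openin (quotient_topology T R) \<U> \<longleftrightarrow> \<U> \<subseteq> topspace T // R \<and> openin T (\<Union>\<U>)"
proof -
  have "istopology (\<lambda>\<U>. \<U> \<subseteq> topspace T // R \<and> openin T (\<Union>\<U>))"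
    unfolding istopology_def
  proof (intro conjI allI impI; (elim conjE)?)
    fix \<U> \<V> assume *: "\<U> \<subseteq> topspace T // R" "\<V> \<subseteq> topspace T // R"
      and o: "openin T (\<Union>\<U>)" "openin T (\<Union>\<V>)"
    have "\<Union>(\<U> \<inter> \<V>) = \<Union>\<U> \<inter> \<Union>\<V>"
    proof
      show "\<Union>\<U> \<inter> \<Union>\<V> \<subseteq> \<Union>(\<U> \<inter> \<V>)"
      proof
        fix z assume "z \<in> \<Union>\<U> \<inter> \<Union>\<V>"
        then obtain U V where UV: "U \<in> \<U>" "z \<in> U" "V \<in> \<V>" "z \<in> V" by blast
        moreover have "U = V"
          using quotient_disj[OF R, of U V] UV * by blast
        ultimately show "z \<in> \<Union>(\<U> \<inter> \<V>)" by blast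
      qed
    qed blast
    then show "openin T (\<Union>(\<U> \<inter> \<V>))" using o by auto
    show "\<U> \<inter> \<V> \<subseteq> topspace T // R" using * by blast
  next
    fix \<K> assume K: "\<forall>\<U>\<in>\<K>. \<U> \<subseteq> topspace T // R \<and> openin T (\<Union>\<U>)"
    show "\<Union>\<K> \<subseteq> topspace T // R" using K by blast
    have "\<Union>(\<Union>\<K>) = \<Union>(Union ` \<K>)" by blast
    then show "openin T (\<Union>(\<Union>\<K>))" using K by auto
  qed
  then show ?thesis by (simp add: quotient_topology_def topology_inverse')
qed

lemma topspace_quotient_topology:
  assumes R: "equiv (topspace T) R"
  shows "topspace (quotient_topology T R) = topspace T // R"
proof -
  have "openin (quotient_topology T R) (topspace T // R)"
    by (simp add: openin_quotient_topology[OF R] Union_quotient[OF R])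
  then show ?thesis
    by (metis R openin_quotient_topology openin_subset openin_topspace subset_antisym)
qed

lemma quotient_map_quotient_topology:
  assumes R: "equiv (topspace T) R"
  shows "quotient_map T (quotient_topology T R) (\<lambda>x. R `` {x})"
  unfolding quotient_map_def
proof (intro conjI allI impI)
  show "(\<lambda>x. R `` {x}) ` topspace T = topspace (quotient_topology T R)"
    by (auto simp: topspace_quotient_topology[OF R] quotient_def)
  fix \<U> assume "\<U> \<subseteq> topspace (quotient_topology T R)"
  then have U: "\<U> \<subseteq> topspace T // R" by (simp add: topspace_quotient_topology[OF R])
  have "{x \<in> topspace T. R `` {x} \<in> \<U>} = \<Union>\<U>"
  proof (intro equalityI subsetI)
    fix x assume "x \<in> {x \<in> topspace T. R `` {x} \<in> \<U>}"
    then show "x \<in> \<Union>\<U>" using equiv_class_self[OF R] by blast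
  next
    fix x assume "x \<in> \<Union>\<U>"
    then obtain c where c: "c \<in> \<U>" "x \<in> c" by blast
    then have cq: "c \<in> topspace T // R" using U by blast
    then have x: "x \<in> topspace T" using c in_quotient_imp_subset[OF R] by blast
    have "R `` {x} = c"
      using quotient_disj[OF R quotientI[OF x] cq] equiv_class_self[OF R x] c by blast
    then show "x \<in> {x \<in> topspace T. R `` {x} \<in> \<U>}" using c x by simp
  qed
  then show "openin T {x \<in> topspace T. R `` {x} \<in> \<U>} = openin (quotient_topology T R) \<U>"
    using U by (simp add: openin_quotient_topology[OF R])
qed

end

theory Submission
  imports Defs
begin

text \<open>Write \<open>K\<close> for the closure of the union of the nontrivial fibers. The classes of the relation
  are the components of \<open>K\<close> and the single points of \<open>X - K\<close>.

  The planar part of the argument says that \<open>X\<close> is connected im kleinen at every point \<open>x\<close> whose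
  fiber is trivial (\<open>connected_im_kleinen_at_trivial_fiber\<close>). Let \<open>x\<close> lie on the frontier of \<open>X\<close>. As
  the pseudo-fiber is compact and \<open>{x}\<close> is one of its components, compactness combines finitely many
  finite separators into one finite set \<open>C\<close> that splits off from the frontier a piece around \<open>x\<close> inside
  a given disk (\<open>finite_cut_around_trivial_fiber\<close>). If a component \<open>P\<close> of \<open>X\<close> intersected with the
  disk runs from near \<open>x\<close> to the boundary circle and misses \<open>C\<close>, the frontier points of \<open>X\<close> in \<open>P\<close> fall into an
  inner and an outer compact set. Some connected set around \<open>x\<close> passes between these two, so it
  avoids the frontier of \<open>P\<close>, but meets \<open>P\<close>, and hence lies in \<open>P\<close>. Every other crossing component
  would have to meet it too, so \<open>P\<close> is the only one (\<open>crossing_components_eq\<close>). Together with the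
  components that meet \<open>C\<close>, only finitely many components come near \<open>x\<close>; since all are closed, the
  one through \<open>x\<close> is a neighborhood of \<open>x\<close> in \<open>X\<close>.

  The second part shows that a continuum which is connected im kleinen off a closed set \<open>K\<close> is so
  along each component of \<open>K\<close> as well (\<open>connected_im_kleinen_at_component\<close>). A component of the
  compact set \<open>K\<close> has small open neighborhoods whose frontier avoids \<open>K\<close>. Finitely many small
  connected neighborhoods cover this frontier, and every component of the closed neighborhood
  reaches the frontier, so adding the former leaves finitely many components.

  Thus \<open>X\<close> is connected im kleinen along every class. The decomposition is upper semicontinuous with
  compact classes, so the quotient is Hausdorff, and connectedness im kleinen passes to it, which
  gives local connectedness. Metrizability holds because a Hausdorff image of a compact second
  countable space carries a countable family of real functions that separates points.\<close>

section \<open>Metrizability of Hausdorff images of compact spaces\<close>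

text \<open>Finite unions \<open>U\<close> of basic open sets of the domain give countably many sets \<open>star U\<close>, consisting
  of the points whose whole fiber lies in \<open>U\<close>. By compactness of fibers these refine the
  neighborhoods of each point. One continuous function for every pair of such sets that some
  continuous function separates is therefore enough to separate all points, and evaluation
  embeds the image in a countable power of the real line.\<close>
lemma metrizable_space_continuous_image_compact:
  assumes T: "compact_space T" "second_countable T" and Y: "Hausdorff_space Y"
    and f: "continuous_map T Y f" and fim: "f ` topspace T = topspace Y"
  shows "metrizable_space Y"
proof -
  obtain \<B> where cB: "countable \<B>" and opB: "\<And>V. V \<in> \<B> \<Longrightarrow> openin T V"
    and bB: "\<And>U x. openin T U \<Longrightarrow> x \<in> U \<Longrightarrow> \<exists>V\<in>\<B>. x \<in> V \<and> V \<subseteq> U"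
    using T(2) unfolding second_countable_def by metis
  define \<U> where "\<U> = Union ` {F. finite F \<and> F \<subseteq> \<B>}"
  have cU: "countable \<U>"
    unfolding \<U>_def by (intro countable_image countable_Collect_finite_subset cB)
  define star where "star U = {y \<in> topspace Y. \<forall>x\<in>topspace T. f x = y \<longrightarrow> x \<in> U}" for U
  have star_base: "\<exists>U\<in>\<U>. y \<in> star U \<and> star U \<subseteq> W"
    if W: "openin Y W" "y \<in> W" for W y
  proof -
    have yY: "y \<in> topspace Y" using W openin_subset by blast
    define K where "K = {x \<in> topspace T. f x \<in> {y}}"
    have "closedin T K"
      unfolding K_def
      by (rule closedin_continuous_map_preimage[OF f]) (simp add: Y closedin_Hausdorff_sing_eq yY)
    then have K: "compactin T K"
      using T(1) closedin_compact_space by blast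
    define P where "P = {x \<in> topspace T. f x \<in> W}"
    have P: "openin T P"
      unfolding P_def by (rule openin_continuous_map_preimage[OF f W(1)])
    have "K \<subseteq> \<Union>{V\<in>\<B>. V \<subseteq> P}"
    proof
      fix x assume "x \<in> K"
      then have "x \<in> P" using W by (auto simp: K_def P_def)
      then show "x \<in> \<Union>{V\<in>\<B>. V \<subseteq> P}" using bB[OF P] by blast
    qed
    then obtain F where F: "finite F" "F \<subseteq> {V\<in>\<B>. V \<subseteq> P}" "K \<subseteq> \<Union>F"
      using compactinD[OF K, of "{V\<in>\<B>. V \<subseteq> P}"] opB by blast
    have "\<Union>F \<in> \<U>" using F by (auto simp: \<U>_def)
    moreover have "y \<in> star (\<Union>F)" using F yY by (auto simp: star_def K_def)
    moreover have "star (\<Union>F) \<subseteq> W"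
    proof
      fix z assume z: "z \<in> star (\<Union>F)"
      then have "z \<in> f ` topspace T" by (simp add: star_def fim)
      then obtain x where "x \<in> topspace T" "f x = z" by blast
      then have "x \<in> P" using z F(2) by (auto simp: star_def)
      then show "z \<in> W" using \<open>f x = z\<close> by (auto simp: P_def)
    qed
    ultimately show ?thesis by blast
  qed
  define \<P> where "\<P> = {(U, V). U \<in> \<U> \<and> V \<in> \<U> \<and> (\<exists>g. continuous_map Y euclideanreal g
      \<and> (\<forall>y\<in>star U. g y < 1/2) \<and> (\<forall>y\<in>star V. g y > 1/2))}"
  have "\<P> \<subseteq> \<U> \<times> \<U>" by (auto simp: \<P>_def)
  then have cP: "countable \<P>" using cU by (metis countable_SIGMA countable_subset)
  have "\<forall>p\<in>\<P>. \<exists>g. continuous_map Y euclideanreal g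
      \<and> (\<forall>y\<in>star (fst p). g y < 1/2) \<and> (\<forall>y\<in>star (snd p). g y > 1/2)"
    by (auto simp: \<P>_def)
  then obtain g where g: "\<And>p. p \<in> \<P> \<Longrightarrow> continuous_map Y euclideanreal (g p)"
    and gl: "\<And>p y. p \<in> \<P> \<Longrightarrow> y \<in> star (fst p) \<Longrightarrow> g p y < 1/2"
    and gr: "\<And>p y. p \<in> \<P> \<Longrightarrow> y \<in> star (snd p) \<Longrightarrow> g p y > (1/2::real)"
    by metis
  define e where "e y = (\<lambda>p\<in>\<P>. g p y)" for y
  have cY: "compact_space Y"
    using T(1) f fim by (metis compact_space_def image_compactin)
  then have reg: "completely_regular_space Y"
    using Y compact_Hausdorff_or_regular_imp_normal_space normal_imp_completely_regular_space_A
      Hausdorff_imp_t1_space by blast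
  have sep: "\<exists>p\<in>\<P>. y \<in> star (fst p) \<and> z \<in> star (snd p)"
    if yz: "y \<in> topspace Y" "z \<in> topspace Y" "y \<noteq> z" for y z
  proof -
    have "closedin Y {z}" using yz Y by (simp add: closedin_Hausdorff_sing_eq)
    then obtain h where h: "continuous_map Y (top_of_set {0..1}) h" "h y = 0" "h ` {z} \<subseteq> {1::real}"
      using reg yz unfolding completely_regular_space_def by blast
    have hc: "continuous_map Y euclideanreal h"
      using h(1) by (simp add: continuous_map_in_subtopology)
    have o1: "openin Y {x \<in> topspace Y. h x \<in> {..<1/2}}"
      by (rule openin_continuous_map_preimage[OF hc]) auto
    have o2: "openin Y {x \<in> topspace Y. h x \<in> {1/2<..}}"
      by (rule openin_continuous_map_preimage[OF hc]) auto
    obtain U where U: "U \<in> \<U>" "y \<in> star U" "star U \<subseteq> {x \<in> topspace Y. h x \<in> {..<1/2}}"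
      using star_base[OF o1, of y] yz h by auto
    obtain V where V: "V \<in> \<U>" "z \<in> star V" "star V \<subseteq> {x \<in> topspace Y. h x \<in> {1/2<..}}"
      using star_base[OF o2, of z] yz h by auto
    have "(U, V) \<in> \<P>" using U V hc by (auto simp: \<P>_def)
    then show ?thesis using U V by force
  qed
  let ?R = "product_topology (\<lambda>p. euclideanreal) \<P>"
  have "continuous_map Y ?R e"
    unfolding continuous_map_componentwise e_def using g by (auto intro: continuous_map_eq)
  moreover have "inj_on e (topspace Y)"
  proof (rule inj_onI, rule ccontr)
    fix y z assume yz: "y \<in> topspace Y" "z \<in> topspace Y" "e y = e z" "y \<noteq> z"
    then obtain p where p: "p \<in> \<P>" "y \<in> star (fst p)" "z \<in> star (snd p)" using sep by blast
    then have "g p y < g p z" using gl[of p y] gr[of p z] by linarith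
    moreover have "g p y = g p z" using fun_cong[OF yz(3), of p] p by (simp add: e_def)
    ultimately show False by simp
  qed
  moreover have "Hausdorff_space ?R" by (simp add: Hausdorff_space_product_topology)
  ultimately have "embedding_map Y ?R e"
    using cY by (intro continuous_imp_embedding_map)
  then have "Y homeomorphic_space subtopology ?R (e ` topspace Y)"
    by (rule embedding_map_imp_homeomorphic_space)
  moreover have "metrizable_space ?R"
    unfolding metrizable_space_product_topology
    using cP metrizable_space_euclidean by (auto intro: countable_subset[of _ \<P>])
  ultimately show ?thesis
    using homeomorphic_metrizable_space metrizable_space_subtopology by blast
qed

lemma second_countable_euclidean:
  "second_countable (euclidean :: 'a::second_countable_topology topology)"
proof -
  obtain B :: "'a set set" where "countable B" "topological_basis B"
    using ex_countable_basis by blast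
  then show ?thesis
    unfolding second_countable_def
    by (intro exI[of _ B]) (metis open_openin topological_basisE topological_basis_open)
qed

section \<open>Connectedness im kleinen\<close>

text \<open>For \<open>c = {x}\<close> this is connectedness im kleinen at the point \<open>x\<close>. Allowing a set \<open>c\<close> lets it speak
  of a class of a decomposition before passing to the quotient.\<close>
definition connected_im_kleinen_at :: "'a::topological_space set \<Rightarrow> 'a set \<Rightarrow> bool" where
  "connected_im_kleinen_at X c \<longleftrightarrow> (\<forall>W. open W \<and> c \<subseteq> W \<longrightarrow>
     (\<exists>G N. connected G \<and> G \<subseteq> X \<inter> W \<and> open N \<and> c \<subseteq> N \<and> X \<inter> N \<subseteq> G))"

text \<open>This is boundary bumping. A component that stays away from \<open>X - F\<close> could be enclosed in a set that is
  compact and relatively open in \<open>X \<inter> F\<close> and still stays away from \<open>X - F\<close>. Such a set is open and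
  closed in \<open>X\<close>, so it is all of \<open>X\<close>, although \<open>X\<close> is not contained in \<open>F\<close>.\<close>
lemma component_meets_closure_Diff:
  fixes X :: "'a::euclidean_space set"
  assumes X: "compact X" "connected X" and F: "closed F" "\<not> X \<subseteq> F"
    and C: "C \<in> components (X \<inter> F)"
  shows "C \<inter> closure (X - F) \<noteq> {}"
proof
  assume disj: "C \<inter> closure (X - F) = {}"
  let ?U = "- closure (X - F)"
  have S: "compact (X \<inter> F)" using X F by (simp add: compact_Int_closed)
  obtain K where K: "openin (top_of_set (X \<inter> F)) K" "compact K" "C \<subseteq> K" "K \<subseteq> ?U"
    using Sura_Bura_clopen_subset[of "X \<inter> F" C ?U] S C disj
    by (metis closed_closure compact_components disjoint_eq_subset_Compl compact_imp_closed
        closed_imp_locally_compact open_Compl)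
  obtain W where W: "open W" "K = X \<inter> F \<inter> W" using K(1) by (auto simp: openin_open)
  have "K = X \<inter> (W \<inter> ?U)"
    using W K(4) closure_subset[of "X - F"] by blast
  then have "openin (top_of_set X) K"
    using W(1) by (metis open_Int openin_open_Int open_Compl closed_closure)
  moreover have "closedin (top_of_set X) K"
    using K(2) W(2) by (simp add: closed_subset compact_imp_closed le_infI1)
  ultimately have "K = {} \<or> K = X" using X(2) connected_clopen by metis
  then show False
    using K(3) C W(2) F(2) in_components_nonempty by blast
qed

text \<open>The components of a closed set are closed, so removing the finitely many other components that
  enter \<open>V\<close> leaves an open set, in which only the component around \<open>c\<close> remains.\<close>
lemma connected_neighbourhood_if_finitely_many_components:
  fixes S :: "'a::euclidean_space set"
  assumes S: "closed S" and V: "open V" and fin: "finite {C \<in> components S. C \<inter> V \<noteq> {}}"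
    and c: "connected c" "c \<noteq> {}" "c \<subseteq> S" "c \<subseteq> V"
  shows "\<exists>G N. connected G \<and> G \<subseteq> S \<and> open N \<and> c \<subseteq> N \<and> N \<subseteq> V \<and> S \<inter> N \<subseteq> G"
proof -
  obtain G where G: "G \<in> components S" "c \<subseteq> G"
    using exists_component_superset[OF c(3) _ c(1)] c(2,3) by blast
  define \<C> where "\<C> = {C \<in> components S. C \<inter> V \<noteq> {}} - {G}"
  have "closed (\<Union>\<C>)"
    using fin closed_components[OF S] by (intro closed_Union) (auto simp: \<C>_def)
  then have "open (V - \<Union>\<C>)" using V by blast
  moreover have "G \<inter> \<Union>\<C> = {}"
    using G components_nonoverlap[of G S] by (auto simp: \<C>_def)
  then have "c \<subseteq> V - \<Union>\<C>" using G c by blast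
  moreover have "S \<inter> (V - \<Union>\<C>) \<subseteq> G"
  proof
    fix z assume z: "z \<in> S \<inter> (V - \<Union>\<C>)"
    then obtain D where D: "D \<in> components S" "z \<in> D"
      using Union_components[of S] by blast
    then have "D = G" using z by (auto simp: \<C>_def)
    then show "z \<in> G" using D by simp
  qed
  ultimately show ?thesis
    using G in_components_connected in_components_subset by (metis Diff_subset)
qed

lemma components_meeting_finite_set:
  assumes "finite C"
  shows "finite {P \<in> components S. P \<inter> C \<noteq> {}}"
proof (rule finite_subset)
  show "{P \<in> components S. P \<inter> C \<noteq> {}} \<subseteq> connected_component_set S ` C"
    by (auto simp: components_def intro: connected_component_eq) (metis connected_component_eq image_eqI mem_Collect_eq)
qed (use assms in simp)

text \<open>The component \<open>c\<close> has arbitrarily small open neighborhoods \<open>V\<close> whose frontier is disjoint from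
  \<open>K\<close>, so \<open>X\<close> is connected im kleinen at all its points on that frontier. By boundary bumping every
  component of \<open>X \<inter> closure V\<close> reaches the frontier and joins one of finitely many small connected
  sets there.\<close>
lemma connected_im_kleinen_at_component:
  fixes X :: "'a::euclidean_space set"
  assumes X: "compact X" "connected X" and K: "closed K" "K \<subseteq> X"
    and cik: "\<And>p. p \<in> X - K \<Longrightarrow> connected_im_kleinen_at X {p}"
    and c: "c \<in> components K"
  shows "connected_im_kleinen_at X c"
  unfolding connected_im_kleinen_at_def
proof (intro allI impI, elim conjE)
  fix W assume W: "open W" "c \<subseteq> W"
  have cc: "connected c" "c \<noteq> {}" "c \<subseteq> X"
    using c K in_components_connected in_components_nonempty in_components_subset by blast+
  have Kc: "compact K" using K X compact_Int_closed[of X K] by (simp add: inf_absorb2)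
  obtain K1 where K1: "openin (top_of_set K) K1" "compact K1" "c \<subseteq> K1" "K1 \<subseteq> W"
    using Sura_Bura_clopen_subset[of K c W] Kc c W
    by (metis compact_components closed_imp_locally_compact K(1))
  have K1K: "K1 \<subseteq> K" using K1(1) openin_imp_subset by blast
  have "closed (K - K1)"
    using K1(1) K(1) by (metis closedin_closed_trans closedin_diff closedin_self)
  then have "closed ((K - K1) \<union> - W)" using W by blast
  moreover have "K1 \<inter> ((K - K1) \<union> - W) = {}" using K1 by blast
  ultimately obtain V V' where V: "open V" "open V'" "K1 \<subseteq> V" "(K - K1) \<union> - W \<subseteq> V'" "V \<inter> V' = {}"
    using separation_normal[of K1 "(K - K1) \<union> - W"] K1(2) compact_imp_closed by metis
  have clV: "closure V \<inter> V' = {}" using V by (simp add: open_Int_closure_eq_empty inf_commute)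
  then have clVW: "closure V \<subseteq> W" using V by blast
  have frK: "closure V - V \<subseteq> W - K" using clV V K1K clVW by blast
  show "\<exists>G N. connected G \<and> G \<subseteq> X \<inter> W \<and> open N \<and> c \<subseteq> N \<and> X \<inter> N \<subseteq> G"
  proof (cases "X \<subseteq> closure V")
    case True
    then show ?thesis using X clVW cc by (intro exI[of _ X] exI[of _ UNIV]) auto
  next
    case False
    define H where "H = X \<inter> (closure V - V)"
    have H: "compact H" unfolding H_def using X V by (intro compact_Int_closed closed_Diff) auto
    have "\<exists>G N. connected G \<and> closed G \<and> G \<subseteq> X \<inter> W \<and> open N \<and> p \<in> N \<and> X \<inter> N \<subseteq> G"
      if "p \<in> H" for p
    proof -
      have p: "p \<in> X - K" "p \<in> W" using that frK by (auto simp: H_def)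
      then obtain e where e: "e > 0" "cball p e \<subseteq> W" using W open_contains_cball by blast
      obtain G N where G: "connected G" "G \<subseteq> X \<inter> ball p e" "open N" "p \<in> N" "X \<inter> N \<subseteq> G"
        using cik[OF p(1)] e(1) unfolding connected_im_kleinen_at_def
        by (metis centre_in_ball empty_subsetI insert_subset open_ball)
      have "closure G \<subseteq> X \<inter> cball p e"
        using G(2) X(1) by (intro closure_minimal) (auto simp: compact_imp_closed less_imp_le subset_iff)
      then have "connected (closure G) \<and> closed (closure G) \<and> closure G \<subseteq> X \<inter> W \<and> open N \<and> p \<in> N \<and> X \<inter> N \<subseteq> closure G"
        using G e closure_subset[of G] connected_imp_connected_closure by blast
      then show ?thesis by blast
    qed
    then obtain G N where GN: "\<And>p. p \<in> H \<Longrightarrow> connected (G p) \<and> closed (G p) \<and> G p \<subseteq> X \<inter> W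
         \<and> open (N p) \<and> p \<in> N p \<and> X \<inter> N p \<subseteq> G p"
      by metis
    \<comment> \<open>The connected sets \<open>G y\<close> glue the possibly infinitely many components of \<open>X \<inter> closure V\<close> into
      at most one component for each \<open>y \<in> Y\<close>.\<close>
    obtain Y where Y: "Y \<subseteq> H" "finite Y" "H \<subseteq> \<Union>(N ` Y)"
      using compactE_image[OF H, of H N] GN by blast
    define Z where "Z = X \<inter> closure V \<union> \<Union>(G ` Y)"
    have Zcl: "closed Z" unfolding Z_def
      using X GN Y by (intro closed_Un closed_Int closed_UN) (auto simp: compact_imp_closed)
    have "components Z \<subseteq> {P \<in> components Z. P \<inter> Y \<noteq> {}}"
    proof
      fix P assume P: "P \<in> components Z"
      have "\<exists>y\<in>Y. P \<inter> G y \<noteq> {}"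
      proof (rule ccontr)
        assume no: "\<not> (\<exists>y\<in>Y. P \<inter> G y \<noteq> {})"
        then have "P \<subseteq> X \<inter> closure V"
          using in_components_subset[OF P] unfolding Z_def by blast
        then have "P \<in> components (X \<inter> closure V)"
          using P by (metis Un_upper1 Z_def components_intermediate_subset)
        then obtain z where z: "z \<in> P" "z \<in> closure (X - closure V)"
          using component_meets_closure_Diff[OF X closed_closure False] by blast
        have "closure (X - closure V) \<subseteq> - V"
          using V closure_subset[of V] by (intro closure_minimal) auto
        then have "z \<in> H" using z \<open>P \<subseteq> X \<inter> closure V\<close> by (auto simp: H_def)
        then obtain y where "y \<in> Y" "z \<in> N y" using Y by blast
        then have "z \<in> G y" using GN[of y] Y \<open>z \<in> H\<close> by (auto simp: H_def)
        then show False using no z \<open>y \<in> Y\<close> by blast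
      qed
      then obtain y where y: "y \<in> Y" "P \<inter> G y \<noteq> {}" by blast
      have "G y \<subseteq> P"
        using components_maximal[OF P, of "G y"] GN[of y] y Y by (auto simp: Z_def)
      moreover have "y \<in> G y"
      proof -
        have "y \<in> H" "y \<in> X" using y Y by (auto simp: H_def)
        then show ?thesis using GN[of y] by blast
      qed
      ultimately show "P \<in> {P \<in> components Z. P \<inter> Y \<noteq> {}}" using y P by blast
    qed
    then have "finite (components Z)"
      using components_meeting_finite_set[OF Y(2), of Z] finite_subset by blast
    then have fin: "finite {C \<in> components Z. C \<inter> V \<noteq> {}}" by simp
    have cV: "c \<subseteq> V" using K1 V by blast
    have cZ: "c \<subseteq> Z" using cV cc closure_subset[of V] by (auto simp: Z_def)
    obtain G' N' where G': "connected G'" "G' \<subseteq> Z" "open N'" "c \<subseteq> N'" "N' \<subseteq> V" "Z \<inter> N' \<subseteq> G'"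
      using connected_neighbourhood_if_finitely_many_components[OF Zcl V(1) fin cc(1,2) cZ cV] by blast
    have "Z \<subseteq> X \<inter> W" using GN Y clVW by (auto simp: Z_def)
    moreover have "X \<inter> N' \<subseteq> Z" using G' closure_subset[of V] by (auto simp: Z_def)
    ultimately have "connected G' \<and> G' \<subseteq> X \<inter> W \<and> open N' \<and> c \<subseteq> N' \<and> X \<inter> N' \<subseteq> G'" using G' by blast
    then show ?thesis by blast
  qed
qed

section \<open>Upper semicontinuous decompositions\<close>

definition upper_semicontinuous_on :: "'a::topological_space set \<Rightarrow> ('a \<times> 'a) set \<Rightarrow> bool" where
  "upper_semicontinuous_on X R \<longleftrightarrow> (\<forall>x\<in>X. \<forall>W. open W \<and> R `` {x} \<subseteq> W \<longrightarrow>
     (\<exists>N. open N \<and> N \<subseteq> W \<and> R `` {x} \<subseteq> N \<and> (\<forall>y\<in>X \<inter> N. R `` {y} \<subseteq> N)))"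

lemma openin_quotient_saturated:
  assumes R: "equiv X R" and "open N" and sat: "\<And>y. y \<in> X \<inter> N \<Longrightarrow> R `` {y} \<subseteq> N"
  shows "openin (quotient_topology (top_of_set X) R) ((\<lambda>y. R `` {y}) ` (X \<inter> N))"
proof -
  have R': "equiv (topspace (top_of_set X)) R" using R by simp
  have "\<Union>((\<lambda>y. R `` {y}) ` (X \<inter> N)) = X \<inter> N"
    using sat equiv_class_self[OF R] equiv_type[OF R] by blast
  then show ?thesis
    unfolding openin_quotient_topology[OF R'] using assms by (auto simp: quotientI)
qed

text \<open>Distinct classes are disjoint compact sets, and upper semicontinuity shrinks disjoint open
  sets around them to saturated ones.\<close>
lemma Hausdorff_space_usc_quotient:
  fixes X :: "'a::euclidean_space set"
  assumes R: "equiv X R" and usc: "upper_semicontinuous_on X R"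
    and cpt: "\<And>x. x \<in> X \<Longrightarrow> compact (R `` {x})"
  shows "Hausdorff_space (quotient_topology (top_of_set X) R)"
  unfolding Hausdorff_space_def
proof (intro allI impI, elim conjE)
  have R': "equiv (topspace (top_of_set X)) R" using R by simp
  fix p q assume p: "p \<in> topspace (quotient_topology (top_of_set X) R)"
    and q: "q \<in> topspace (quotient_topology (top_of_set X) R)" and "p \<noteq> q"
  obtain x y where x: "x \<in> X" "p = R `` {x}" and y: "y \<in> X" "q = R `` {y}"
    using p q by (auto simp: topspace_quotient_topology[OF R'] quotient_def)
  have "p \<inter> q = {}"
    using quotient_disj[OF R, of p q] x y \<open>p \<noteq> q\<close> quotientI by metis
  then obtain U V where UV: "open U" "open V" "p \<subseteq> U" "q \<subseteq> V" "U \<inter> V = {}"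
    using separation_normal[of p q] cpt x y compact_imp_closed by metis
  obtain U' where U': "open U'" "U' \<subseteq> U" "p \<subseteq> U'" "\<And>y. y \<in> X \<inter> U' \<Longrightarrow> R `` {y} \<subseteq> U'"
    using usc x UV unfolding upper_semicontinuous_on_def by metis
  obtain V' where V': "open V'" "V' \<subseteq> V" "q \<subseteq> V'" "\<And>y. y \<in> X \<inter> V' \<Longrightarrow> R `` {y} \<subseteq> V'"
    using usc y UV unfolding upper_semicontinuous_on_def by metis
  let ?U = "(\<lambda>y. R `` {y}) ` (X \<inter> U')" and ?V = "(\<lambda>y. R `` {y}) ` (X \<inter> V')"
  have "disjnt ?U ?V"
    unfolding disjnt_iff
  proof (intro allI notI, elim conjE)
    fix s assume "s \<in> ?U" "s \<in> ?V"
    then obtain a b where a: "a \<in> X \<inter> U'" "s = R `` {a}" and b: "b \<in> X \<inter> V'" "s = R `` {b}" by blast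
    have "a \<in> s" using a equiv_class_self[OF R] by blast
    moreover have "s \<subseteq> U'" "s \<subseteq> V'" using a(2) b(2) U'(4)[OF a(1)] V'(4)[OF b(1)] by simp_all
    ultimately show False using U'(2) V'(2) UV(5) by blast
  qed
  moreover have "p \<in> ?U" "q \<in> ?V"
    using x y U'(3) V'(3) equiv_class_self[OF R] by blast+
  ultimately show "\<exists>U V. openin (quotient_topology (top_of_set X) R) U \<and>
       openin (quotient_topology (top_of_set X) R) V \<and> p \<in> U \<and> q \<in> V \<and> disjnt U V"
    using openin_quotient_saturated[OF R U'(1,4)] openin_quotient_saturated[OF R V'(1,4)] by blast
qed

text \<open>The image of a connected set that is a neighborhood of a class is a connected neighborhood of
  the corresponding point, again because it contains a saturated neighborhood. This is the weak
  form of local connectedness; holding at all points, it implies the strong one.\<close>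
lemma locally_connected_space_usc_quotient:
  assumes R: "equiv X R" and usc: "upper_semicontinuous_on X R"
    and cik: "\<And>x. x \<in> X \<Longrightarrow> connected_im_kleinen_at X (R `` {x})"
  shows "locally_connected_space (quotient_topology (top_of_set X) R)"
  unfolding locally_connected_space_im_kleinen
proof (intro allI impI, elim conjE)
  let ?Q = "quotient_topology (top_of_set X) R" and ?\<pi> = "\<lambda>x. R `` {x}"
  have R': "equiv (topspace (top_of_set X)) R" using R by simp
  have cont: "continuous_map (top_of_set X) ?Q ?\<pi>"
    using quotient_map_quotient_topology[OF R'] quotient_imp_continuous_map by blast
  fix \<V> q assume \<V>: "openin ?Q \<V>" and q: "q \<in> \<V>"
  have "\<V> \<subseteq> X // R" "openin (top_of_set X) (\<Union>\<V>)"
    using \<V> by (auto simp: openin_quotient_topology[OF R'])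
  then obtain W where W: "open W" "\<Union>\<V> = X \<inter> W" by (auto simp: openin_open)
  obtain x where x: "x \<in> X" "q = ?\<pi> x" using q \<open>\<V> \<subseteq> X // R\<close> by (auto simp: quotient_def)
  have inV: "?\<pi> z \<in> \<V>" if z: "z \<in> X \<inter> W" for z
  proof -
    obtain v where v: "v \<in> \<V>" "z \<in> v" using z W by blast
    then have "v \<in> X // R" using \<open>\<V> \<subseteq> X // R\<close> by blast
    then have "?\<pi> z = v"
      using quotient_disj[OF R, of "?\<pi> z" v] equiv_class_self[OF R, of z] z v
      by (metis Int_iff disjoint_iff quotientI)
    then show ?thesis using v by simp
  qed
  have "q \<subseteq> W" using q W by blast
  then obtain G N where G: "connected G" "G \<subseteq> X \<inter> W" "open N" "q \<subseteq> N" "X \<inter> N \<subseteq> G"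
    using cik[OF x(1)] W x unfolding connected_im_kleinen_at_def by metis
  obtain N' where N': "open N'" "N' \<subseteq> N" "q \<subseteq> N'" "\<And>y. y \<in> X \<inter> N' \<Longrightarrow> ?\<pi> y \<subseteq> N'"
    using usc x G unfolding upper_semicontinuous_on_def by metis
  have xO: "x \<in> X \<inter> N'" using x N' equiv_class_self[OF R] by auto
  have "connectedin ?Q (?\<pi> ` G)"
    using G by (intro connectedin_continuous_map_image[OF cont]) (auto simp: connectedin_subtopology)
  moreover have "?\<pi> ` G \<subseteq> \<V>" using inV G by blast
  moreover have "?\<pi> ` (X \<inter> N') \<subseteq> ?\<pi> ` G" using G N' by blast
  moreover have "openin ?Q (?\<pi> ` (X \<inter> N'))" by (rule openin_quotient_saturated[OF R N'(1,4)])
  moreover have "q \<in> ?\<pi> ` (X \<inter> N')" using xO x by blast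
  moreover have "q \<in> ?\<pi> ` G" using xO G(5) N'(2) x(2) by blast
  ultimately have "openin ?Q (?\<pi> ` (X \<inter> N')) \<and> q \<in> ?\<pi> ` (X \<inter> N') \<and> ?\<pi> ` (X \<inter> N') \<subseteq> \<V> \<and>
      (\<forall>y\<in>?\<pi> ` (X \<inter> N'). connectedin ?Q (?\<pi> ` G) \<and> ?\<pi> ` G \<subseteq> \<V> \<and> q \<in> ?\<pi> ` G \<and> y \<in> ?\<pi> ` G)"
    by (simp only: subset_iff simp_thms) blast
  then show "\<exists>U. openin ?Q U \<and> q \<in> U \<and> U \<subseteq> \<V> \<and> (\<forall>y\<in>U. \<exists>C. connectedin ?Q C \<and> C \<subseteq> \<V> \<and> q \<in> C \<and> y \<in> C)"
    by meson
qed

definition collapse_components :: "'a::topological_space set \<Rightarrow> 'a set \<Rightarrow> ('a \<times> 'a) set" where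
  "collapse_components X K = {(x, y). x \<in> X \<and> y \<in> X \<and> (x = y \<or> connected_component K x y)}"

lemma collapse_components_class:
  assumes "K \<subseteq> X" "x \<in> X"
  shows "collapse_components X K `` {x} = (if x \<in> K then connected_component_set K x else {x})"
proof (cases "x \<in> K")
  case True
  then have "connected_component_set K x \<subseteq> X" "connected_component K x x"
    using connected_component_subset assms(1) by (blast, simp)
  then show ?thesis using True assms(2) by (auto simp: collapse_components_def)
next
  case False
  then have "\<not> connected_component K x y" for y using connected_component_in by metis
  then show ?thesis using False assms(2) by (auto simp: collapse_components_def)
qed

text \<open>A neighborhood \<open>W\<close> of a component of \<open>K\<close> contains a piece \<open>K1\<close> around it that is open and closed in
  \<open>K\<close>. No component of \<open>K\<close> is cut by \<open>K1\<close>, so deleting the rest of \<open>K\<close> from \<open>W\<close> makes it saturated.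
  For a point off \<open>K\<close> the same works with \<open>K1\<close> empty.\<close>
lemma upper_semicontinuous_on_collapse_components:
  fixes X :: "'a::euclidean_space set"
  assumes K: "compact K" "K \<subseteq> X"
  shows "upper_semicontinuous_on X (collapse_components X K)"
  unfolding upper_semicontinuous_on_def
proof (intro ballI allI impI, elim conjE)
  let ?R = "collapse_components X K"
  fix x W assume x: "x \<in> X" and W: "open W" "?R `` {x} \<subseteq> W"
  obtain K1 where K1: "openin (top_of_set K) K1" "closed K1" "K1 \<subseteq> W"
      "?R `` {x} \<inter> (K - K1) = {}"
  proof (cases "x \<in> K")
    case True
    then have c: "?R `` {x} \<in> components K"
      using collapse_components_class[OF K(2) x] by (auto simp: components_def)
    obtain K1 where "openin (top_of_set K) K1" "compact K1" "?R `` {x} \<subseteq> K1" "K1 \<subseteq> W"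
      using Sura_Bura_clopen_subset[of K "?R `` {x}" W] K c W
      by (metis compact_components closed_imp_locally_compact compact_imp_closed)
    then show ?thesis using that[of K1] compact_imp_closed by blast
  next
    case False
    then show ?thesis using that[of "{}"] collapse_components_class[OF K(2) x] by simp
  qed
  define N where "N = W - (K - K1)"
  obtain U where U: "open U" "K1 = K \<inter> U" using K1(1) by (auto simp: openin_open)
  have "K - K1 = K \<inter> - U" using U(2) by blast
  then have "closed (K - K1)" using K(1) U(1) by (simp add: closed_Int compact_imp_closed closed_Compl)
  then have "open N" using W by (auto simp: N_def)
  moreover have "?R `` {y} \<subseteq> N" if y: "y \<in> X \<inter> N" for y
  proof (cases "y \<in> K")
    case True
    then have "y \<in> K1" using y by (auto simp: N_def)
    let ?c = "connected_component_set K y"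
    have "U \<inter> ?c = {} \<or> - K1 \<inter> ?c = {}"
      using connected_component_subset[of K y] U K1(2)
      by (intro connectedD[OF connected_connected_component] open_Compl K1(2)) auto
    moreover have "y \<in> U \<inter> ?c" using True \<open>y \<in> K1\<close> U by simp
    ultimately have "?c \<subseteq> K1" by blast
    then show ?thesis
      using collapse_components_class[OF K(2), of y] True y K1 by (auto simp: N_def)
  next
    case False
    then show ?thesis using collapse_components_class[OF K(2), of y] y by auto
  qed
  ultimately show "\<exists>N. open N \<and> N \<subseteq> W \<and> ?R `` {x} \<subseteq> N \<and> (\<forall>y\<in>X \<inter> N. ?R `` {y} \<subseteq> N)"
    using W K1(4) by (intro exI[of _ N]) (auto simp: N_def)
qed

section \<open>Points with trivial fiber\<close>

text \<open>The set \<open>T1\<close> together with the inner ball and \<open>T2\<close> together with the outside of the outer ball are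
  disjoint closed sets. The frontier of an open set between them separates \<open>x\<close> from a point outside, and
  by unicoherence of Euclidean space so does one of its components \<open>\<gamma>\<close>. A connected set that crosses
  the annulus without meeting \<open>\<gamma>\<close> would link the inner ball to the outside, which is connected in
  dimension at least two.\<close>
lemma connected_separator_of_annulus:
  fixes x :: "'a::euclidean_space"
  assumes dim: "2 \<le> DIM('a)" and \<rho>: "0 \<le> \<rho>" "\<rho> < r"
    and T: "closed T1" "closed T2" "T1 \<inter> T2 = {}" "T1 \<subseteq> ball x r" "T2 \<inter> cball x \<rho> = {}"
  obtains \<gamma> where "connected \<gamma>" "\<gamma> \<subseteq> ball x r" "\<gamma> \<inter> (T1 \<union> T2) = {}"
    "\<And>Z. connected Z \<Longrightarrow> Z \<inter> cball x \<rho> \<noteq> {} \<Longrightarrow> \<not> Z \<subseteq> ball x r \<Longrightarrow> Z \<inter> \<gamma> \<noteq> {}"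
proof -
  let ?E1 = "T1 \<union> cball x \<rho>" and ?E2 = "T2 \<union> - ball x r"
  have "closed ?E1" "closed ?E2" using T by auto
  moreover have "?E1 \<inter> ?E2 = {}" using T \<rho> by (auto simp: subset_iff)
  ultimately obtain U V where UV: "open U" "open V" "?E1 \<subseteq> U" "?E2 \<subseteq> V" "U \<inter> V = {}"
    using separation_normal by metis
  have "closure U \<inter> V = {}" using UV by (simp add: open_Int_closure_eq_empty inf_commute)
  moreover have "frontier U \<inter> U = {}" using UV(1) by (simp add: frontier_disjoint_eq)
  ultimately have fr: "frontier U \<inter> (?E1 \<union> ?E2) = {}"
    using UV(3,4) unfolding frontier_def by blast
  obtain b :: 'a where b: "b \<in> Basis" using nonempty_Basis by blast
  define q where "q = x + r *\<^sub>R b"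
  have q: "q \<in> ?E2" using b \<rho> by (simp add: q_def dist_norm)
  have x: "x \<in> ?E1" using \<rho> by simp
  have "\<not> connected_component (- frontier U) x q"
  proof
    assume "connected_component (- frontier U) x q"
    then obtain t where t: "connected t" "t \<subseteq> - frontier U" "x \<in> t" "q \<in> t"
      unfolding connected_component_def by blast
    have "t \<inter> frontier U \<noteq> {}"
      using t(1) by (rule connected_Int_frontier) (use t q x UV in blast)+
    then show False using t by blast
  qed
  then obtain \<gamma> where \<gamma>: "\<gamma> \<in> components (frontier U)" "\<not> connected_component (- \<gamma>) x q"
    using separation_by_component_closed_pointwise frontier_closed by metis
  have \<gamma>U: "\<gamma> \<subseteq> frontier U" using \<gamma>(1) in_components_subset by blast
  show ?thesis
  proof (rule that)
    show "connected \<gamma>" using \<gamma>(1) in_components_connected by blast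
    show "\<gamma> \<subseteq> ball x r" "\<gamma> \<inter> (T1 \<union> T2) = {}" using \<gamma>U fr by blast+
    fix Z assume Z: "connected Z" "Z \<inter> cball x \<rho> \<noteq> {}" "\<not> Z \<subseteq> ball x r"
    show "Z \<inter> \<gamma> \<noteq> {}"
    proof
      assume no: "Z \<inter> \<gamma> = {}"
      have "connected (- ball x r)"
        using dim by (intro connected_complement_bounded_convex) auto
      moreover have "connected (cball x \<rho> \<union> Z)" using Z by (intro connected_Un) auto
      ultimately have "connected ((cball x \<rho> \<union> Z) \<union> - ball x r)"
        using Z by (intro connected_Un) auto
      moreover have "(cball x \<rho> \<union> Z) \<union> - ball x r \<subseteq> - \<gamma>" using no \<gamma>U fr by blast
      moreover have "x \<in> cball x \<rho>" "q \<in> - ball x r" using \<rho> b by (auto simp: q_def dist_norm)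
      ultimately show False using \<gamma>(2) unfolding connected_component_def by blast
    qed
  qed
qed

text \<open>The connected separator \<open>\<gamma>\<close> of \<open>T1\<close> and \<open>T2\<close> meets every crossing component. Inside the open ball
  the frontier of \<open>P\<close> consists of frontier points of \<open>X\<close>, since a ball around an interior point of
  \<open>X\<close> belongs to a single component. So \<open>\<gamma>\<close> misses the frontier of \<open>P\<close> and lies inside \<open>P\<close>, and every
  other crossing component meets \<open>P\<close>.\<close>
lemma crossing_components_eq:
  fixes X :: "'a::euclidean_space set"
  assumes dim: "2 \<le> DIM('a)" and \<rho>: "0 \<le> \<rho>" "\<rho> < r" and X: "closed X"
    and T: "closed T1" "closed T2" "T1 \<inter> T2 = {}" "T1 \<subseteq> ball x r" "T2 \<inter> cball x \<rho> = {}"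
    and P: "P \<in> components (X \<inter> cball x r)" "P \<inter> cball x \<rho> \<noteq> {}" "\<not> P \<subseteq> ball x r"
    and PT: "P \<inter> frontier X \<subseteq> T1 \<union> T2"
    and P': "P' \<in> components (X \<inter> cball x r)" "P' \<inter> cball x \<rho> \<noteq> {}" "\<not> P' \<subseteq> ball x r"
  shows "P' = P"
proof -
  obtain \<gamma> where \<gamma>: "connected \<gamma>" "\<gamma> \<subseteq> ball x r" "\<gamma> \<inter> (T1 \<union> T2) = {}"
    "\<And>Z. connected Z \<Longrightarrow> Z \<inter> cball x \<rho> \<noteq> {} \<Longrightarrow> \<not> Z \<subseteq> ball x r \<Longrightarrow> Z \<inter> \<gamma> \<noteq> {}"
    using connected_separator_of_annulus[OF dim \<rho> T] by blast
  have "P \<inter> \<gamma> \<noteq> {}" using \<gamma>(4) P in_components_connected by blast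
  have "\<gamma> \<inter> frontier P = {}"
  proof (rule ccontr)
    assume "\<gamma> \<inter> frontier P \<noteq> {}"
    then obtain w where w: "w \<in> \<gamma>" "w \<in> frontier P" by blast
    have "closed P" using P(1) X closed_components by blast
    then have "w \<in> P" using w frontier_subset_closed by blast
    have "w \<notin> frontier X" using PT \<gamma>(3) w \<open>w \<in> P\<close> by blast
    moreover have "w \<in> X" using \<open>w \<in> P\<close> P(1) in_components_subset by blast
    ultimately have "w \<in> interior X \<inter> ball x r"
      using w \<gamma>(2) closure_subset[of X] by (auto simp: frontier_def)
    then obtain e where e: "e > 0" "ball w e \<subseteq> interior X \<inter> ball x r"
      by (metis open_Int open_ball open_contains_ball open_interior)
    then have "ball w e \<subseteq> X \<inter> cball x r" using interior_subset[of X] by (force simp: subset_iff)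
    then have "ball w e \<subseteq> P"
      using components_maximal[OF P(1), of "ball w e"] \<open>w \<in> P\<close> e(1) centre_in_ball[of w e] by blast
    then have "w \<in> interior P" using e(1) by (meson centre_in_ball interiorI open_ball)
    then show False using w by (simp add: frontier_def)
  qed
  then have "\<gamma> \<subseteq> P" using connected_Int_frontier[of \<gamma> P] \<gamma>(1) \<open>P \<inter> \<gamma> \<noteq> {}\<close> by blast
  moreover have "P' \<inter> \<gamma> \<noteq> {}" using \<gamma>(4) P' in_components_connected by blast
  ultimately show ?thesis using components_nonoverlap[OF P'(1) P(1)] by blast
qed

text \<open>The side \<open>A\<close> alone determines a separation. Expressing it by two closed sets makes it easy to
  intersect several separations.\<close>
lemma separated_byE:
  assumes "separated_by X C x y"  "closed C" "C \<subseteq> frontier X"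
  obtains A where "A \<subseteq> frontier X - C" "x \<in> A" "y \<in> frontier X" "y \<notin> A \<union> C"
    "closed (A \<union> C)" "closed (frontier X - A)"
proof -
  obtain A B where AB: "frontier X - C = A \<union> B" "closure A \<inter> B = {}" "A \<inter> closure B = {}" "x \<in> A" "y \<in> B"
    using assms unfolding separated_by_def by blast
  have AF: "closure A \<subseteq> frontier X" "closure B \<subseteq> frontier X"
    using AB(1) by (intro closure_minimal frontier_closed; blast)+
  have "A \<union> C = closure A \<union> C" using AB(1,2) AF closure_subset[of A] by blast
  then have "closed (A \<union> C)" by (metis assms(2) closed_Un closed_closure)
  moreover have "frontier X - A = closure B \<union> C"
    using AB(1,3) AF assms(3) closure_subset[of B] by blast
  then have "closed (frontier X - A)" by (metis assms(2) closed_Un closed_closure)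
  moreover have "y \<notin> A \<union> C" "y \<in> frontier X" using AB closure_subset[of A] by blast+
  moreover have "A \<subseteq> frontier X - C" using AB(1) by blast
  ultimately show ?thesis using that[of A] AB(4) by blast
qed

text \<open>A separation of \<open>x\<close> from \<open>y\<close> by a finite set also separates \<open>x\<close> from all frontier points near
  \<open>y\<close>.\<close>
lemma closed_mod_pseudo_fiber: "closed (mod_pseudo_fiber X x)"
proof (cases "x \<in> interior X")
  case True
  then show ?thesis by (simp add: mod_pseudo_fiber_def)
next
  case False
  have "\<exists>N. open N \<and> y \<in> N \<and> N \<inter> mod_pseudo_fiber X x = {}" if y: "y \<notin> mod_pseudo_fiber X x" for y
  proof (cases "y \<in> frontier X")
    case False
    then show ?thesis using \<open>x \<notin> interior X\<close>
      by (intro exI[of _ "- frontier X"]) (auto simp: mod_pseudo_fiber_def)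
  next
    case True
    then obtain C where C: "finite C" "C \<subseteq> frontier X" "separated_by X C x y"
      using y \<open>x \<notin> interior X\<close> by (auto simp: mod_pseudo_fiber_def)
    then obtain A B where AB: "frontier X - C = A \<union> B" "closure A \<inter> B = {}" "A \<inter> closure B = {}" "x \<in> A" "y \<in> B"
      unfolding separated_by_def by blast
    let ?N = "- (closure A \<union> C)"
    have "open ?N" using C(1) by (intro open_Compl closed_Un closed_closure finite_imp_closed)
    moreover have "y \<in> ?N" using AB by blast
    moreover have "z \<notin> mod_pseudo_fiber X x" if "z \<in> ?N" for z
    proof
      assume z: "z \<in> mod_pseudo_fiber X x"
      then have "z \<in> frontier X" using False by (simp add: mod_pseudo_fiber_def)
      then have "z \<in> B" using that AB(1) closure_subset[of A] by blast
      then have "separated_by X C x z" using AB unfolding separated_by_def by blast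
      then show False using z C False by (auto simp: mod_pseudo_fiber_def)
    qed
    ultimately show ?thesis by blast
  qed
  note isolate = this
  have "open (- mod_pseudo_fiber X x)"
  proof (rule Topological_Spaces.openI)
    fix y assume "y \<in> - mod_pseudo_fiber X x"
    then obtain N where "open N" "y \<in> N" "N \<inter> mod_pseudo_fiber X x = {}" using isolate by blast
    then show "\<exists>T. open T \<and> y \<in> T \<and> T \<subseteq> - mod_pseudo_fiber X x" by blast
  qed
  then show ?thesis by (simp only: closed_def)
qed

lemma mem_mod_pseudo_fiber:
  assumes "x \<in> X"
  shows "x \<in> mod_pseudo_fiber X x"
proof -
  have "\<not> separated_by X C x x" for C
    unfolding separated_by_def using closure_subset by blast
  moreover have "x \<in> frontier X" if "x \<notin> interior X"
    using assms that closure_subset by (auto simp: frontier_def)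
  ultimately show ?thesis by (auto simp: mod_pseudo_fiber_def)
qed

text \<open>Since \<open>{x}\<close> is a component of the compact pseudo-fiber, there is an open set \<open>U\<close> around \<open>x\<close>, inside
  the ball, whose frontier avoids the pseudo-fiber. Each point of the frontier of \<open>X\<close> on the
  frontier of \<open>U\<close> is separated from \<open>x\<close> by a finite set, and finitely many of these separations deal
  with all such points. The intersection of their sides at \<open>x\<close> does not reach the frontier of \<open>U\<close>, so
  cutting it down to \<open>U\<close> still yields a separation.\<close>
lemma finite_cut_around_trivial_fiber:
  assumes X: "compact X" and x: "x \<in> frontier X" and triv: "mod_fiber X x = {x}" and r: "0 < r"
  obtains C A where "finite C" "C \<subseteq> frontier X" "A \<subseteq> frontier X - C" "x \<in> A" "A \<subseteq> ball x r"
    "closed (A \<union> C)" "closed (frontier X - A)"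
proof -
  let ?E = "mod_pseudo_fiber X x" and ?F = "frontier X"
  have xi: "x \<notin> interior X" using x by (simp add: frontier_def)
  have xX: "x \<in> X" using x X frontier_subset_closed compact_imp_closed by blast
  have EF: "?E \<subseteq> ?F" using xi by (auto simp: mod_pseudo_fiber_def)
  have Fc: "compact ?F" using X by (simp add: compact_frontier)
  then have Ec: "compact ?E"
    using EF closed_mod_pseudo_fiber by (metis compact_Int_closed inf.absorb2)
  have "{x} \<in> components ?E"
    using triv mem_mod_pseudo_fiber[OF xX] unfolding mod_fiber_def components_def by blast
  then obtain E1 where E1: "openin (top_of_set ?E) E1" "compact E1" "x \<in> E1" "E1 \<subseteq> ball x r"
    using Sura_Bura_clopen_subset[of ?E "{x}" "ball x r"] r closed_mod_pseudo_fiber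
    by (metis centre_in_ball closed_imp_locally_compact compact_sing empty_subsetI insert_subset open_ball)
  have "closed (?E - E1)"
    using E1(1) closed_mod_pseudo_fiber by (metis closedin_closed_trans closedin_diff closedin_self)
  then have "closed ((?E - E1) \<union> - ball x r)" by blast
  moreover have "E1 \<inter> ((?E - E1) \<union> - ball x r) = {}" using E1(4) by blast
  ultimately obtain U V where UV: "open U" "open V" "E1 \<subseteq> U" "(?E - E1) \<union> - ball x r \<subseteq> V" "U \<inter> V = {}"
    using separation_normal[of E1 "(?E - E1) \<union> - ball x r"] E1(2) compact_imp_closed by metis
  have clU: "closure U \<inter> V = {}" using UV by (simp add: open_Int_closure_eq_empty inf_commute)
  define H where "H = ?F \<inter> (closure U - U)"
  have H: "compact H" unfolding H_def using Fc UV by (intro compact_Int_closed closed_Diff) auto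
  have "\<exists>C A. finite C \<and> C \<subseteq> ?F \<and> A \<subseteq> ?F - C \<and> x \<in> A \<and> y \<notin> A \<union> C \<and> closed (A \<union> C) \<and> closed (?F - A)"
    if "y \<in> H" for y
  proof -
    have "y \<in> ?F" "y \<notin> ?E" using that clU UV E1 by (auto simp: H_def)
    then obtain C where C: "finite C" "C \<subseteq> ?F" "separated_by X C x y"
      using xi by (auto simp: mod_pseudo_fiber_def)
    then show ?thesis using separated_byE[OF C(3) finite_imp_closed[OF C(1)] C(2)] by metis
  qed
  then obtain C A where CA: "\<And>y. y \<in> H \<Longrightarrow> finite (C y) \<and> C y \<subseteq> ?F \<and> A y \<subseteq> ?F - C y \<and> x \<in> A y
      \<and> y \<notin> A y \<union> C y \<and> closed (A y \<union> C y) \<and> closed (?F - A y)"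
    by metis
  obtain Y where Y: "Y \<subseteq> H" "finite Y" "H \<subseteq> (\<Union>y\<in>Y. - (A y \<union> C y))"
    using compactE_image[OF H, of H "\<lambda>y. - (A y \<union> C y)"] CA by (metis (no_types, lifting) ComplI UN_I open_Compl subsetI)
  define C' where "C' = (\<Union>y\<in>Y. C y)"
  define A' where "A' = (?F \<inter> U \<inter> (\<Inter>y\<in>Y. A y)) - C'"
  have C': "finite C'" "C' \<subseteq> ?F" using Y CA unfolding C'_def by blast+
  show ?thesis
  proof (rule that[OF C'])
    show "A' \<subseteq> ?F - C'" by (auto simp: A'_def)
    show "A' \<subseteq> ball x r" using UV by (auto simp: A'_def)
    show "x \<in> A'" using x CA Y UV E1 by (auto simp: A'_def C'_def)
    have "A' \<union> C' = C' \<union> (?F \<inter> closure U \<inter> (\<Inter>y\<in>Y. A y \<union> C y))"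
    proof (intro equalityI subsetI)
      fix z assume z: "z \<in> C' \<union> (?F \<inter> closure U \<inter> (\<Inter>y\<in>Y. A y \<union> C y))"
      show "z \<in> A' \<union> C'"
      proof (cases "z \<in> C'")
        case False
        then have z': "z \<in> ?F" "z \<in> closure U" "\<And>y. y \<in> Y \<Longrightarrow> z \<in> A y"
          using z by (auto simp: C'_def)
        have "z \<in> U"
        proof (rule ccontr)
          assume "z \<notin> U"
          then have "z \<in> H" using z' by (simp add: H_def)
          then show False using Y z' by blast
        qed
        then show ?thesis using z' False by (auto simp: A'_def)
      qed simp
    next
      fix z assume "z \<in> A' \<union> C'"
      then show "z \<in> C' \<union> (?F \<inter> closure U \<inter> (\<Inter>y\<in>Y. A y \<union> C y))"
        using closure_subset[of U] by (auto simp: A'_def)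
    qed
    moreover have "closed (\<Inter>y\<in>Y. A y \<union> C y)" using CA Y by (intro closed_INT) blast
    ultimately show "closed (A' \<union> C')" using C'(1) by (simp add: closed_Int closed_Un finite_imp_closed)
    have "?F - A' = (?F \<inter> - U) \<union> C' \<union> (\<Union>y\<in>Y. ?F - A y)"
      using C'(2) by (auto simp: A'_def)
    moreover have "closed (\<Union>y\<in>Y. ?F - A y)" using CA Y by (intro closed_UN) auto
    ultimately show "closed (?F - A')"
      using C'(1) UV(1) by (simp add: closed_Int closed_Un finite_imp_closed closed_Compl)
  qed
qed

text \<open>Unless \<open>X\<close> lies in the ball of radius \<open>r\<close> around \<open>x\<close>, by boundary bumping every component of \<open>X \<inter> cball x r\<close> that comes close to \<open>x\<close> crosses to the
  sphere of radius \<open>r\<close>. Finitely many of them meet the finite cut \<open>C\<close>, and at most one misses it.\<close>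
lemma connected_im_kleinen_at_trivial_fiber:
  assumes X: "compact X" "connected X" and x: "x \<in> X" and triv: "mod_fiber X x = {x}"
  shows "connected_im_kleinen_at X {x}"
  unfolding connected_im_kleinen_at_def
proof (intro allI impI, elim conjE)
  fix W assume W: "open W" "{x} \<subseteq> W"
  show "\<exists>G N. connected G \<and> G \<subseteq> X \<inter> W \<and> open N \<and> {x} \<subseteq> N \<and> X \<inter> N \<subseteq> G"
  proof (cases "x \<in> interior X")
    case True
    then obtain e where e: "e > 0" "ball x e \<subseteq> interior X \<inter> W"
      using W by (metis IntI insert_subset open_Int open_contains_ball open_interior)
    then show ?thesis using interior_subset[of X]
      by (intro exI[of _ "ball x e"]) auto
  next
    case False
    then have xF: "x \<in> frontier X" using x closure_subset by (auto simp: frontier_def)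
    obtain r where r: "r > 0" "cball x r \<subseteq> W" using W open_contains_cball by blast
    show ?thesis
    proof (cases "X \<subseteq> cball x r")
      case True
      then show ?thesis using X r by (intro exI[of _ X] exI[of _ UNIV]) auto
    next
      case nsub: False
      obtain C A where CA: "finite C" "C \<subseteq> frontier X" "A \<subseteq> frontier X - C" "x \<in> A" "A \<subseteq> ball x r"
        "closed (A \<union> C)" "closed (frontier X - A)"
        using finite_cut_around_trivial_fiber[OF X(1) xF triv r(1)] .
      \<comment> \<open>In the ball of radius \<open>\<rho>\<close> all frontier points of \<open>X\<close> belong to \<open>A\<close>.\<close>
      have "open (ball x r \<inter> - (frontier X - A))" "x \<in> ball x r \<inter> - (frontier X - A)"
        using CA(4) r(1) open_Int[OF open_ball open_Compl[OF CA(7)]] by simp_all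
      then obtain \<rho> where \<rho>: "\<rho> > 0" "cball x \<rho> \<subseteq> ball x r \<inter> - (frontier X - A)"
        using open_contains_cball by metis
      have "\<rho> < r"
      proof -
        have "x + of_real \<rho> \<in> cball x \<rho>" using \<rho> by (simp add: dist_norm)
        then have "x + of_real \<rho> \<in> ball x r" using \<rho> by blast
        then show ?thesis using \<rho> by (simp add: dist_norm)
      qed
      let ?S = "X \<inter> cball x r"
      define \<G> where "\<G> = {P \<in> components ?S. P \<inter> ball x \<rho> \<noteq> {}}"
      have cross: "P \<inter> cball x \<rho> \<noteq> {} \<and> \<not> P \<subseteq> ball x r" if "P \<in> \<G>" for P
      proof -
        have P: "P \<in> components ?S" "P \<inter> ball x \<rho> \<noteq> {}" using that by (auto simp: \<G>_def)
        then obtain z where z: "z \<in> P" "z \<in> closure (X - cball x r)"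
          using component_meets_closure_Diff[OF X closed_cball nsub] by blast
        have "closure (X - cball x r) \<subseteq> - ball x r" by (intro closure_minimal) auto
        then show ?thesis using z P(2) ball_subset_cball[of x \<rho>] by blast
      qed
      have one: "P' = P" if P: "P \<in> \<G>" "P \<inter> C = {}" and P': "P' \<in> \<G>" for P P'
      proof -
        have Pc: "P \<in> components ?S" "P' \<in> components ?S" using P P' by (auto simp: \<G>_def)
        have clP: "closed P" using Pc(1) X closed_components compact_imp_closed by blast
        have "P \<inter> A = P \<inter> (A \<union> C)" using P by blast
        then have 1: "closed (P \<inter> A)" using clP CA by (simp add: closed_Int)
        have 2: "closed (P \<inter> (frontier X - A))" using clP CA by (simp add: closed_Int)
        show ?thesis
          by (rule crossing_components_eq[OF _ _ \<open>\<rho> < r\<close> _ 1 2 _ _ _ Pc(1) _ _ _ Pc(2)])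
             (use cross[OF P(1)] cross[OF P'] \<rho> CA X compact_imp_closed in auto)
      qed
      have "\<G> \<subseteq> {P \<in> components ?S. P \<inter> C \<noteq> {}} \<union> {P \<in> \<G>. P \<inter> C = {}}" by (auto simp: \<G>_def)
      moreover have "finite {P \<in> \<G>. P \<inter> C = {}}"
      proof (cases "{P \<in> \<G>. P \<inter> C = {}} = {}")
        case False
        then obtain P where "P \<in> \<G>" "P \<inter> C = {}" by blast
        then have "{P \<in> \<G>. P \<inter> C = {}} \<subseteq> {P}" using one by blast
        then show ?thesis using finite_subset by blast
      qed (simp only: finite.emptyI)
      ultimately have fin: "finite \<G>"
        using components_meeting_finite_set[OF CA(1), of ?S] by (meson finite_UnI finite_subset)
      have "closed ?S" using X compact_imp_closed by blast
      then obtain G N where G: "connected G" "G \<subseteq> ?S" "open N" "{x} \<subseteq> N" "N \<subseteq> ball x \<rho>" "?S \<inter> N \<subseteq> G"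
        using connected_neighbourhood_if_finitely_many_components[of ?S "ball x \<rho>" "{x}"] fin x r \<rho>(1)
        unfolding \<G>_def by auto
      have "X \<inter> N \<subseteq> ?S"
        using G(5) ball_subset_cball[of x \<rho>] subset_cball[of \<rho> r x] \<open>\<rho> < r\<close> by auto
      then have "connected G \<and> G \<subseteq> X \<inter> W \<and> open N \<and> {x} \<subseteq> N \<and> X \<inter> N \<subseteq> G" using G r by blast
      then show ?thesis by blast
    qed
  qed
qed

section \<open>The quotient by the fibers\<close>

lemma nontrivial_fibers_union_subset:
  assumes "closed X"
  shows "closure (nontrivial_fibers_union X) \<subseteq> X"
proof (rule closure_minimal[OF _ assms])
  have "mod_pseudo_fiber X x \<subseteq> X" if "x \<in> X" for x
    using that frontier_subset_closed[OF assms] by (auto simp: mod_pseudo_fiber_def)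
  then show "nontrivial_fibers_union X \<subseteq> X"
    using connected_component_subset unfolding nontrivial_fibers_union_def mod_fiber_def by blast
qed

lemma fiber_rel_eq_collapse_components:
  "fiber_rel X = collapse_components X (closure (nontrivial_fibers_union X))"
  unfolding fiber_rel_def collapse_components_def by auto

theorem theorem3:
  fixes X :: "complex set"
  assumes "X \<noteq> {}" and "compact X" and "connected X"
  defines "Q \<equiv> quotient_topology (top_of_set X) (fiber_rel X)"
  shows "metrizable_space Q \<and> topspace Q \<noteq> {} \<and> compact_space Q \<and> connected_space Q
         \<and> locally_connected_space Q"
proof -
  define K where "K = closure (nontrivial_fibers_union X)"
  let ?R = "fiber_rel X"
  have X: "compact X" "connected X" "closed X" using assms compact_imp_closed by auto
  have R: "equiv X ?R" by (rule equiv_fiber_rel)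
  then have R': "equiv (topspace (top_of_set X)) ?R" by simp
  have K: "closed K" "K \<subseteq> X" "compact K"
    using nontrivial_fibers_union_subset[OF X(3)] compact_Int_closed[OF X(1), of K]
    by (simp_all add: K_def inf.absorb2)
  have cls: "?R `` {x} = (if x \<in> K then connected_component_set K x else {x})" if "x \<in> X" for x
    using collapse_components_class[OF K(2) that]
    unfolding fiber_rel_eq_collapse_components K_def[symmetric] .
  \<comment> \<open>As \<open>x\<close> belongs to its own fiber, a nontrivial fiber of \<open>x\<close> would put \<open>x\<close> into \<open>K\<close>.\<close>
  have cik0: "connected_im_kleinen_at X {x}" if x: "x \<in> X - K" for x
  proof (rule connected_im_kleinen_at_trivial_fiber[OF X(1,2)])
    show "x \<in> X" using x by blast
    then have "x \<in> mod_fiber X x"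
      unfolding mod_fiber_def using mem_mod_pseudo_fiber by simp
    moreover have "x \<notin> nontrivial_fibers_union X"
      using x closure_subset unfolding K_def by blast
    ultimately show "mod_fiber X x = {x}"
      using \<open>x \<in> X\<close> unfolding nontrivial_fibers_union_def by blast
  qed
  have cik: "connected_im_kleinen_at X (?R `` {x})" if x: "x \<in> X" for x
  proof (cases "x \<in> K")
    case True
    then have "connected_component_set K x \<in> components K" by (auto simp: components_def)
    then show ?thesis
      using connected_im_kleinen_at_component[OF X(1,2) K(1,2) cik0] cls[OF x] True by simp
  next
    case False
    then show ?thesis using cik0[of x] cls[OF x] x by simp
  qed
  have usc: "upper_semicontinuous_on X ?R"
    using upper_semicontinuous_on_collapse_components[OF K(3,2)]
    unfolding fiber_rel_eq_collapse_components K_def .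
  have "compact (?R `` {x})" if "x \<in> X" for x
    using cls[OF that] K(3) by (auto intro: compact_components simp: components_def)
  then have Haus: "Hausdorff_space Q"
    unfolding Q_def by (rule Hausdorff_space_usc_quotient[OF R usc])
  have q: "quotient_map (top_of_set X) Q (\<lambda>x. ?R `` {x})"
    unfolding Q_def by (rule quotient_map_quotient_topology[OF R'])
  have cont: "continuous_map (top_of_set X) Q (\<lambda>x. ?R `` {x})"
    and im: "(\<lambda>x. ?R `` {x}) ` topspace (top_of_set X) = topspace Q"
    using q quotient_imp_continuous_map quotient_imp_surjective_map by blast+
  have cX: "compact_space (top_of_set X)" and nX: "connected_space (top_of_set X)"
    using X by (simp_all add: compact_space_subtopology connected_space_subtopology)
  have "second_countable (top_of_set X)"
    by (rule second_countable_subtopology[OF second_countable_euclidean])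
  then have "metrizable_space Q"
    using metrizable_space_continuous_image_compact[OF cX _ Haus cont im] by blast
  moreover have "topspace Q \<noteq> {}" using im assms(1) by auto
  moreover have "compact_space Q"
    using cX cont im by (metis compact_space_def image_compactin)
  moreover have "connected_space Q"
    using nX cont im by (metis connectedin_continuous_map_image connectedin_topspace)
  moreover have "locally_connected_space Q"
    unfolding Q_def by (rule locally_connected_space_usc_quotient[OF R usc cik])
  ultimately show ?thesis by blast
qed

end
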